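(* Let $n \geq 3$ and let $f, g : S^{n-1} \to \mathbb{R}$ be two twice continuously differentiable functions on the unit sphere $S^{n-1} \subset \mathbb{E}^n$. Assume that for any $2$-dimensional plane $\alpha \subset \mathbb{E}^n$ passing through the origin there exist a vector $a_\alpha \in \alpha$ and a rotation $\phi_\alpha \in SO(2,\alpha)$ such that $$f(\phi_\alpha(u)) + a_\alpha \cdot u = g(u) \quad \text{for all } u \in S^{n-1} \cap \alpha.$$ Assume moreover that for every such plane $\alpha$ the restrictions of $f$ and of $g$ to the large circle $S^{n-1} \cap \alpha$ do not satisfy the direct rigid motion symmetry equation. Then there exists $b \in \mathbb{E}^n$ such that either $g(u) = f(u) + b \cdot u$ for all $u \in S^{n-1}$, or $g(u) = f(-u) + b \cdot u$ for all $u \in S^{n-1}$.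
   Context: $\mathbb{E}^n$ is $n$-dimensional Euclidean space with scalar product $x \cdot y$, and $S^{n-1}$ is the set of its unit vectors. For a $2$-dimensional plane $\alpha$ through the origin, $SO(2,\alpha)$ denotes the group of rotations of $\alpha$ (orthogonal linear maps $\alpha \to \alpha$ of determinant $1$). A function $h$ on the circle $S^{n-1}\cap\alpha$ satisfies the direct rigid motion symmetry equation if there exist a non-trivial (i.e. non-identity) rotation $\phi \in SO(2,\alpha)$ and a vector $a \in \alpha$ such that $h(\phi(u)) + a \cdot u = h(u)$ for every $u \in S^{n-1} \cap \alpha$. *)

theory Defs
  imports "HOL-Analysis.Analysis"
begin

definition plane_through_origin :: "'a::euclidean_space set \<Rightarrow> bool" where
  "plane_through_origin \<alpha> \<longleftrightarrow> subspace \<alpha> \<and> dim \<alpha> = 2"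

definition orthonormal_frame :: "'a::euclidean_space set \<Rightarrow> (2 \<Rightarrow> 'a) \<Rightarrow> bool" where
  "orthonormal_frame \<alpha> e \<longleftrightarrow>
     (\<forall>i j. e i \<bullet> e j = (if i = j then 1 else 0)) \<and> span (range e) = \<alpha>"

text \<open>
  The group \<open>SO(2,\<alpha>)\<close> of a plane \<open>\<alpha>\<close>. A map of \<open>\<alpha>\<close> is represented by a function on the
  whole space of which only the values on \<open>\<alpha>\<close> matter. Its determinant is that of its matrix in
  an orthonormal basis of \<open>\<alpha>\<close>; the value does not depend on the basis.
\<close>
definition SO2 :: "'a::euclidean_space set \<Rightarrow> ('a \<Rightarrow> 'a) set" where
  "SO2 \<alpha> = {\<phi>.
     \<phi> ` \<alpha> \<subseteq> \<alpha> \<and>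
     (\<forall>x\<in>\<alpha>. \<forall>y\<in>\<alpha>. \<phi> (x + y) = \<phi> x + \<phi> y) \<and>
     (\<forall>c. \<forall>x\<in>\<alpha>. \<phi> (c *\<^sub>R x) = c *\<^sub>R \<phi> x) \<and>
     (\<forall>x\<in>\<alpha>. \<forall>y\<in>\<alpha>. \<phi> x \<bullet> \<phi> y = x \<bullet> y) \<and>
     (\<exists>e. orthonormal_frame \<alpha> e \<and> det ((\<chi> i j. e i \<bullet> \<phi> (e j)) :: real ^ 2 ^ 2) = 1)}"

definition direct_rigid_motion_symmetry ::
    "'a::euclidean_space set \<Rightarrow> ('a \<Rightarrow> real) \<Rightarrow> bool" where
  "direct_rigid_motion_symmetry \<alpha> h \<longleftrightarrow>
     (\<exists>\<phi>\<in>SO2 \<alpha>. \<exists>a\<in>\<alpha>. (\<exists>x\<in>\<alpha>. \<phi> x \<noteq> x) \<and>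
        (\<forall>u\<in>sphere 0 1 \<inter> \<alpha>. h (\<phi> u) + a \<bullet> u = h u))"

text \<open>Intended for open \<open>U\<close> only: the derivatives are not taken within \<open>U\<close>.\<close>
definition C2_on :: "'a::euclidean_space set \<Rightarrow> ('a \<Rightarrow> real) \<Rightarrow> bool" where
  "C2_on U F \<longleftrightarrow>
     (\<exists>(F' :: 'a \<Rightarrow> 'a \<Rightarrow>\<^sub>L real) (F'' :: 'a \<Rightarrow> 'a \<Rightarrow>\<^sub>L ('a \<Rightarrow>\<^sub>L real)).
        (\<forall>x\<in>U. (F has_derivative blinfun_apply (F' x)) (at x)) \<and>
        (\<forall>x\<in>U. (F' has_derivative blinfun_apply (F'' x)) (at x)) \<and>
        continuous_on U F'')"

text \<open>
  A function on the submanifold \<open>sphere 0 1\<close> is of class \<open>C\<^sup>2\<close> if near each point it is the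
  restriction of a \<open>C\<^sup>2\<close> function of the ambient space.
\<close>
definition C2_on_sphere :: "('a::euclidean_space \<Rightarrow> real) \<Rightarrow> bool" where
  "C2_on_sphere f \<longleftrightarrow>
     (\<forall>p\<in>sphere 0 1. \<exists>U F. open U \<and> p \<in> U \<and> C2_on U F \<and>
        (\<forall>x\<in>U \<inter> sphere 0 1. F x = f x))"

end

theory Submission
  imports Defs
begin

text \<open>
  Everything takes place in three-dimensional subspaces, which are afterwards glued together. In a
  space of dimension three the planes through the origin are the sets \<open>w\<^sup>\<bottom>\<close> with \<open>w\<close> a unit vector, and
  \<open>w\<close> orients its plane, so that the rotation in \<open>w\<^sup>\<bottom>\<close> is a unit complex number \<open>z(w)\<close>. Since \<open>f\<close>
  has no direct symmetry on any great circle, \<open>z(w)\<close> is unique (\<open>fits_unique\<close>), and by compactness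
  it depends continuously on \<open>w\<close> (\<open>continuous_ang\<close>); reversing \<open>w\<close> conjugates it.

  The sphere is simply connected, hence \<open>z = exp (i \<theta>)\<close> with \<open>\<theta>\<close> continuous. The continuous function
  \<open>\<theta>(w) + \<theta>(-w)\<close> takes values in \<open>2\<pi>\<int>\<close>, so it is a constant \<open>2\<pi>k\<close>, and \<open>\<theta> - \<pi>k\<close> is odd. It
  therefore has a zero on every great circle: with \<open>\<epsilon> = (-1)\<^sup>k\<close>, every vector \<open>u\<close> is orthogonal to
  some unit vector \<open>w\<close> with \<open>z(w) = \<epsilon>\<close> (\<open>ex_sign\<close>). So the difference \<open>D(u) = g(u) - f(\<epsilon>u)\<close>, extended
  homogeneously, is the restriction of a linear functional to some plane through any given vector.

  This makes \<open>D\<close> linear (\<open>linear_if_linear_on_many_planes\<close>). If three planes on which \<open>D\<close> is linear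
  have linearly independent normals, then a single functional agrees with \<open>D\<close> on all three of them,
  and any further plane on which \<open>D\<close> is linear meets these in enough lines to force agreement there
  too. Otherwise all the normals lie on one great circle \<open>p\<^sup>\<bottom>\<close>, and then they fill it, so
  \<open>D(s p + t q) = s D(p) + t D(q)\<close> for \<open>q \<bottom> p\<close>; differentiability of \<open>D\<close> at \<open>p\<close> makes
  \<open>D\<close> linear on \<open>p\<^sup>\<bottom>\<close>.

  Finally, the sign \<open>\<epsilon>\<close> is the same for all three-dimensional subspaces: two of them sharing a plane
  have the same sign, as otherwise the half-turn would be a symmetry of \<open>f\<close> on that plane, and
  any two are joined by a chain in which consecutive members share a plane. Then \<open>D\<close> is linear on
  each three-dimensional subspace, hence on the whole space.
\<close>

unbundle cross3_syntax

section \<open>Rotations about an axis in three-space\<close>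

text \<open>
  The rotation by the argument of the unit complex number \<open>z\<close> in the plane orthogonal to the unit
  vector \<open>w\<close>, oriented by \<open>w\<close>. Only its values on that plane are meaningful.
\<close>
definition rot :: "real^3 \<Rightarrow> complex \<Rightarrow> real^3 \<Rightarrow> real^3" where
  "rot w z u = Re z *\<^sub>R u + Im z *\<^sub>R (w \<times> u)"

lemma cross_cross_perp:
  fixes u w :: "real^3"
  assumes "norm w = 1" "u \<bullet> w = 0"
  shows "w \<times> (w \<times> u) = - u"
  using assms by (simp add: Lagrange norm_eq_1 inner_commute)

lemma rot_perp: "u \<bullet> w = 0 \<Longrightarrow> rot w z u \<bullet> w = 0"
  by (simp add: rot_def inner_left_distrib dot_cross_self)

lemma rot_one [simp]: "rot w 1 u = u"
  by (simp add: rot_def)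

lemma rot_rot:
  assumes "norm w = 1" "u \<bullet> w = 0"
  shows "rot w z (rot w z' u) = rot w (z * z') u"
  using cross_cross_perp[OF assms]
  by (simp add: rot_def cross_add_right cross_mult_right algebra_simps)

lemma rot_minus_axis: "rot (- w) z u = rot w (cnj z) u"
  by (simp add: rot_def)

lemma rot_of_real: "rot w (of_real c) u = c *\<^sub>R u"
  by (simp add: rot_def)

lemma inner_rot_rot:
  assumes "norm w = 1" "norm z = 1" "u \<bullet> w = 0" "v \<bullet> w = 0"
  shows "rot w z u \<bullet> rot w z v = u \<bullet> v"
proof -
  have z: "Re z * Re z + Im z * Im z = 1"
    using assms(2) cmod_power2[of z] by (simp add: power2_eq_square)
  have w: "(w \<times> u) \<bullet> (w \<times> v) = u \<bullet> v"
    using assms by (simp add: dot_cross norm_eq_1 inner_commute)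
  have s: "u \<bullet> (w \<times> v) = - ((w \<times> u) \<bullet> v)"
    by (simp add: cross3_simps)
  have "rot w z u \<bullet> rot w z v = (Re z * Re z + Im z * Im z) * (u \<bullet> v)"
    by (simp add: rot_def inner_left_distrib inner_right_distrib w s algebra_simps)
  then show ?thesis by (simp add: z)
qed

lemma norm_rot:
  assumes "norm w = 1" "norm z = 1" "u \<bullet> w = 0"
  shows "norm (rot w z u) = norm u"
  using inner_rot_rot[OF assms(1,2,3,3)] by (simp add: norm_eq_sqrt_inner)

lemma ex_unit_perp:
  fixes w :: "real^3"
  obtains v where "norm v = 1" "v \<bullet> w = 0"
proof -
  obtain y where y: "y \<noteq> 0" "orthogonal w y"
    using orthogonal_to_vector_exists[of w] by auto
  show ?thesis
    by (rule that[of "y /\<^sub>R norm y"]) (use y in \<open>auto simp: orthogonal_def inner_commute\<close>)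
qed

lemma norm_cross_unit:
  fixes u w :: "real^3"
  assumes "norm w = 1" "norm u = 1" "u \<bullet> w = 0"
  shows "norm (w \<times> u) = 1"
  using norm_cross[of w u] assms by (simp add: inner_commute abs_square_eq_1)

lemma perp_eq_cross:
  fixes u w :: "real^3"
  assumes w: "norm w = 1" and u: "u \<bullet> w = 0"
  shows "u = w \<times> (u \<times> w)"
  using assms by (simp add: Lagrange norm_eq_1 inner_commute)

section \<open>Uniqueness and continuity of the rotation angle\<close>

text \<open>
  The three-dimensional situation. The functions live on the whole space, and each great circle is
  replaced by the full plane \<open>w\<^sup>\<bottom>\<close>; for the positively homogeneous extensions of functions on the
  sphere this is equivalent. The translation vector is any vector of the space, since only its
  orthogonal projection to \<open>w\<^sup>\<bottom>\<close> matters.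
\<close>
locale circlewise_congruent =
  fixes F G :: "real^3 \<Rightarrow> real"
  assumes contF: "continuous_on UNIV F" and contG: "continuous_on UNIV G"
    and congruent: "\<And>w. norm w = 1 \<Longrightarrow>
      \<exists>z a. norm z = 1 \<and> (\<forall>u. u \<bullet> w = 0 \<longrightarrow> F (rot w z u) + a \<bullet> u = G u)"
    and rigid: "\<And>w z a. \<lbrakk>norm w = 1; norm z = 1;
      \<And>u. u \<bullet> w = 0 \<Longrightarrow> F (rot w z u) + a \<bullet> u = F u\<rbrakk> \<Longrightarrow> z = 1"
begin

text \<open>
  On the plane \<open>w\<^sup>\<bottom>\<close>, the function \<open>F\<close> is carried to \<open>G\<close> by the rotation \<open>z\<close> and the translation
  vector \<open>a\<close>.
\<close>
definition fits :: "real^3 \<Rightarrow> complex \<Rightarrow> real^3 \<Rightarrow> bool" where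
  "fits w z a \<longleftrightarrow> norm z = 1 \<and> (\<forall>u. u \<bullet> w = 0 \<longrightarrow> F (rot w z u) + a \<bullet> u = G u)"

lemma fits_unique:
  assumes w: "norm w = 1" and "fits w z a" "fits w z' a'"
  shows "z' = z"
proof -
  have z: "norm z = 1" "norm z' = 1" using assms by (auto simp: fits_def)
  have zz: "z * cnj z = 1" using z by (simp add: complex_norm_square[symmetric])
  have "z' * cnj z = 1"
  proof (rule rigid[OF w])
    show "norm (z' * cnj z) = 1" using z by (simp add: norm_mult)
    \<comment> \<open>Substituting \<open>u = rot w (cnj z) v\<close> in the two relations exhibits \<open>z' * cnj z\<close> as a symmetry.\<close>
    let ?c = "rot w z ((a' - a) - ((a' - a) \<bullet> w) *\<^sub>R w)"
    fix v :: "real^3" assume v: "v \<bullet> w = 0"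
    let ?u = "rot w (cnj z) v"
    have u: "?u \<bullet> w = 0" using v by (rule rot_perp)
    have "rot w z ?u = v" using rot_rot[OF w v] zz by simp
    moreover have "rot w z' ?u = rot w (z' * cnj z) v" using rot_rot[OF w v] by simp
    moreover have "F (rot w z ?u) + a \<bullet> ?u = F (rot w z' ?u) + a' \<bullet> ?u"
      using assms u by (simp add: fits_def)
    moreover have "?c \<bullet> v = (a' - a) \<bullet> ?u"
    proof -
      let ?d = "(a' - a) - ((a' - a) \<bullet> w) *\<^sub>R w"
      have d: "?d \<bullet> w = 0" using w by (simp add: inner_diff_left norm_eq_1)
      have "?c \<bullet> v = rot w z ?d \<bullet> rot w z ?u" using \<open>rot w z ?u = v\<close> by simp
      also have "\<dots> = ?d \<bullet> ?u" by (rule inner_rot_rot[OF w z(1) d u])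
      also have "\<dots> = (a' - a) \<bullet> ?u" using u by (simp add: inner_diff_left inner_commute[of w])
      finally show ?thesis .
    qed
    ultimately show "F (rot w (z' * cnj z) v) + ?c \<bullet> v = F v"
      by (simp add: inner_diff_left)
  qed
  then have "z' * (z * cnj z) = z" by (simp add: mult.left_commute)
  then show ?thesis by (simp add: zz)
qed

lemma fits_minus_axis: "fits w z a \<Longrightarrow> fits (- w) (cnj z) a"
  by (simp add: fits_def rot_minus_axis)

text \<open>
  The rotation of the plane \<open>w\<^sup>\<bottom>\<close> that carries \<open>F\<close> to \<open>G\<close>, as a unit complex number. It is meaningful
  only for unit vectors \<open>w\<close>.
\<close>
definition ang :: "real^3 \<Rightarrow> complex" where
  "ang w = (SOME z. \<exists>a. fits w z a)"

lemma ang_fits: "norm w = 1 \<Longrightarrow> \<exists>a. fits w (ang w) a"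
  unfolding ang_def by (rule someI_ex) (use congruent in \<open>auto simp: fits_def\<close>)

lemma ang_eq: "norm w = 1 \<Longrightarrow> fits w z a \<Longrightarrow> ang w = z"
  using ang_fits fits_unique by blast

lemma norm_ang: "norm w = 1 \<Longrightarrow> norm (ang w) = 1"
  using ang_fits by (auto simp: fits_def)

lemma ang_minus: "norm w = 1 \<Longrightarrow> ang (- w) = cnj (ang w)"
  by (metis ang_eq ang_fits fits_minus_axis norm_minus_cancel)

text \<open>
  A uniform bound on the translation vectors, needed for the compactness argument below: a vector
  \<open>c\<close> in \<open>w\<^sup>\<bottom>\<close> is controlled by its product with the unit vector in its own direction, which is a
  difference of values of \<open>G\<close> and \<open>F\<close> on the unit sphere.
\<close>
lemma fits_bounded:
  obtains M where "\<And>w. norm w = 1 \<Longrightarrow> \<exists>a. norm a \<le> M \<and> fits w (ang w) a"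
proof -
  have "compact ((\<lambda>x. (F x, G x)) ` sphere 0 1)"
    by (intro compact_continuous_image continuous_on_Pair)
       (auto intro: continuous_on_subset[OF contF] continuous_on_subset[OF contG])
  then obtain B where "\<forall>y \<in> (\<lambda>x. (F x, G x)) ` sphere 0 1. norm y \<le> B"
    using compact_imp_bounded bounded_iff by metis
  then have B: "\<And>x. x \<in> sphere 0 1 \<Longrightarrow> norm (F x, G x) \<le> B" by blast
  have B': "\<bar>F x\<bar> \<le> B" "\<bar>G x\<bar> \<le> B" if "norm x = 1" for x
    using B[of x] that norm_fst_le[of "F x" "G x"] norm_snd_le[of "G x" "F x"] by auto
  have "\<exists>a. norm a \<le> 2 * B \<and> fits w (ang w) a" if w: "norm w = 1" for w
  proof -
    obtain a where a: "fits w (ang w) a" using ang_fits[OF w] by blast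
    define c where "c = a - (a \<bullet> w) *\<^sub>R w"
    have cw: "c \<bullet> w = 0" using w by (simp add: c_def inner_diff_left norm_eq_1)
    have cu: "c \<bullet> u = a \<bullet> u" if "u \<bullet> w = 0" for u
      using that by (simp add: c_def inner_diff_left inner_commute[of w])
    have fc: "fits w (ang w) c" using a by (simp add: fits_def cu)
    have "norm c \<le> 2 * B"
    proof (cases "c = 0")
      case True
      then show ?thesis using B'(1)[OF w] by simp
    next
      case False
      let ?u = "c /\<^sub>R norm c"
      have u: "?u \<bullet> w = 0" "norm ?u = 1" using cw False by auto
      have "norm c = c \<bullet> ?u" using False by (simp add: power2_norm_eq_inner[symmetric] power2_eq_square)
      also have "\<dots> = G ?u - F (rot w (ang w) ?u)"
      proof -
        have "F (rot w (ang w) ?u) + c \<bullet> ?u = G ?u" using fc u(1) unfolding fits_def by blast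
        then show ?thesis by linarith
      qed
      also have "\<dots> \<le> 2 * B"
        using B'(2)[OF u(2)] B'(1)[of "rot w (ang w) ?u"] norm_rot[OF w norm_ang[OF w] u(1)] u(2)
        by (simp add: abs_le_iff)
      finally show ?thesis .
    qed
    with fc show ?thesis by blast
  qed
  then show ?thesis using that by blast
qed

text \<open>
  The set of all triples of a unit vector, a rotation and a bounded translation vector that fit is
  compact, and the graph of \<open>ang\<close> is its projection.
\<close>
lemma continuous_ang: "continuous_on (sphere 0 1) ang"
proof -
  obtain M where M: "\<And>w. norm w = 1 \<Longrightarrow> \<exists>a. norm a \<le> M \<and> fits w (ang w) a"
    using fits_bounded by blast
  have F': "continuous_on UNIV (\<lambda>x. F (h x))" if "continuous_on UNIV h" for h :: "(real^3) * complex * (real^3) \<Rightarrow> _"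
    using continuous_on_compose2[OF contF that] by simp
  have G': "continuous_on UNIV (\<lambda>x. G (h x))" if "continuous_on UNIV h" for h :: "(real^3) * complex * (real^3) \<Rightarrow> _"
    using continuous_on_compose2[OF contG that] by simp
  have cr: "continuous_on UNIV (\<lambda>x. h x \<times> k x)" if "continuous_on UNIV h" "continuous_on UNIV k"
    for h k :: "(real^3) * complex * (real^3) \<Rightarrow> _"
    using that by (simp add: continuous_on_cross)
  (* Writing the vectors orthogonal to w as cross products of w with arbitrary y makes the range of
     the quantifier independent of w, so that the condition is an intersection of closed ones.
     The products of sets are written as Sigma because the cross product occupies their symbol. *)
  define T where "T = Sigma (sphere (0::real^3) 1) (\<lambda>_. Sigma (sphere (0::complex) 1) (\<lambda>_. cball (0::real^3) M)) \<inter>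
     (\<Inter>y. {p. F (rot (fst p) (fst (snd p)) (fst p \<times> y)) + snd (snd p) \<bullet> (fst p \<times> y) = G (fst p \<times> y)})"
  have "closed (\<Inter>y. {p::(real^3) * complex * (real^3). F (rot (fst p) (fst (snd p)) (fst p \<times> y)) + snd (snd p) \<bullet> (fst p \<times> y) = G (fst p \<times> y)})"
    unfolding rot_def
    by (intro closed_INT ballI closed_Collect_eq continuous_intros F' G' cr)
  then have "compact T"
    unfolding T_def by (intro compact_Int_closed compact_Times) auto
  moreover have "(\<lambda>w. (w, ang w)) ` sphere 0 1 = (\<lambda>p. (fst p, fst (snd p))) ` T"
  proof (intro set_eqI iffI)
    fix q assume "q \<in> (\<lambda>w. (w, ang w)) ` sphere 0 1"
    then obtain w where w: "norm w = 1" "q = (w, ang w)" by auto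
    obtain a where a: "norm a \<le> M" "fits w (ang w) a" using M[OF w(1)] by blast
    have "(w, ang w, a) \<in> T"
      using w a norm_ang[OF w(1)] by (auto simp: T_def fits_def dot_cross_self)
    then show "q \<in> (\<lambda>p. (fst p, fst (snd p))) ` T" using w(2) by force
  next
    fix q assume "q \<in> (\<lambda>p. (fst p, fst (snd p))) ` T"
    then obtain w z a where q: "q = (w, z)" and T: "(w, z, a) \<in> T" by auto
    have w: "norm w = 1" and z: "norm z = 1"
      and e: "\<And>y. F (rot w z (w \<times> y)) + a \<bullet> (w \<times> y) = G (w \<times> y)"
      using T by (auto simp: T_def)
    have "fits w z a"
      unfolding fits_def using z e perp_eq_cross[OF w] by metis
    then have "ang w = z" using ang_eq[OF w] by blast
    then show "q \<in> (\<lambda>w. (w, ang w)) ` sphere 0 1" using q w by auto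
  qed
  ultimately have "compact ((\<lambda>w. (w, ang w)) ` sphere 0 1)"
    by (simp add: compact_continuous_image continuous_on_fst continuous_on_snd continuous_on_Pair)
  then show ?thesis
    by (intro continuous_from_closed_graph[of "sphere 0 1"])
       (auto simp: norm_ang intro: compact_imp_closed)
qed

section \<open>Planes on which the rotation is plus or minus the identity\<close>

text \<open>
  The topological heart of the argument: up to a global sign, the rotation is trivial on some plane
  through any given vector.
\<close>
lemma ex_sign:
  obtains \<epsilon> :: real where "\<epsilon> = 1 \<or> \<epsilon> = -1"
    "\<And>u. \<exists>w a. norm w = 1 \<and> u \<bullet> w = 0 \<and> fits w (of_real \<epsilon>) a"
proof -
  let ?S = "sphere (0::real^3) 1"
  have "Borsukian ?S" by (rule Borsukian_sphere) simp
  moreover have "continuous_on ?S ang \<and> ang \<in> ?S \<rightarrow> sphere (0::complex) 1"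
    using continuous_ang by (auto simp: norm_ang)
  ultimately have "\<exists>\<theta>. continuous_on ?S (complex_of_real \<circ> \<theta>) \<and>
      (\<forall>w\<in>?S. ang w = exp (\<i> * of_real (\<theta> w)))"
    unfolding Borsukian_continuous_logarithm_circle_real by blast
  then obtain \<theta> where c\<theta>: "continuous_on ?S (complex_of_real \<circ> \<theta>)"
    and \<theta>: "\<And>w. norm w = 1 \<Longrightarrow> ang w = exp (\<i> * of_real (\<theta> w))"
    by auto
  have cont\<theta>: "continuous_on ?S \<theta>"
    using continuous_on_Re[OF c\<theta>] by (simp add: o_def)
  have cont\<theta>': "continuous_on ?S (\<lambda>w. \<theta> (- w))"
    by (rule continuous_on_compose2[OF cont\<theta>]) (auto intro: continuous_intros)
  have sum_in: "\<exists>n::int. \<theta> w + \<theta> (- w) = 2 * pi * n" if w: "norm w = 1" for w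
  proof -
    have "exp (\<i> * of_real (\<theta> w + \<theta> (- w))) = ang w * ang (- w)"
      using w by (simp add: \<theta> exp_add[symmetric] algebra_simps)
    also have "\<dots> = 1"
      using norm_ang[OF w] by (simp add: ang_minus[OF w] complex_norm_square[symmetric])
    finally obtain n :: int where "\<theta> w + \<theta> (- w) = of_int (2 * n) * pi"
      by (auto simp: exp_eq_1)
    then show ?thesis by (intro exI[of _ n]) (simp add: mult_ac)
  qed
  have "(\<lambda>w. \<theta> w + \<theta> (- w)) constant_on ?S"
  proof (rule continuous_discrete_range_constant)
    show "connected ?S" by (rule connected_sphere) simp
    show "continuous_on ?S (\<lambda>w. \<theta> w + \<theta> (- w))"
      by (intro continuous_intros cont\<theta> cont\<theta>')
    fix x assume x: "x \<in> ?S"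
    show "\<exists>e>0. \<forall>y. y \<in> ?S \<and> \<theta> y + \<theta> (- y) \<noteq> \<theta> x + \<theta> (- x) \<longrightarrow>
        e \<le> norm (\<theta> y + \<theta> (- y) - (\<theta> x + \<theta> (- x)))"
    proof (intro exI[of _ "2 * pi"] conjI allI impI)
      fix y assume y: "y \<in> ?S \<and> \<theta> y + \<theta> (- y) \<noteq> \<theta> x + \<theta> (- x)"
      obtain m n :: int where mn: "\<theta> x + \<theta> (- x) = 2 * pi * m" "\<theta> y + \<theta> (- y) = 2 * pi * n"
        using sum_in[of x] sum_in[of y] x y by auto
      then have "\<bar>n - m\<bar> \<ge> 1" using y by force
      then have "\<bar>real_of_int n - real_of_int m\<bar> \<ge> 1" by linarith
      moreover have "2 * pi * n - 2 * pi * m = 2 * pi * (real_of_int n - m)"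
        by (simp add: algebra_simps)
      ultimately show "2 * pi \<le> norm (\<theta> y + \<theta> (- y) - (\<theta> x + \<theta> (- x)))"
        unfolding mn by (simp add: abs_mult)
    qed simp
  qed
  then obtain s where s: "\<And>w. norm w = 1 \<Longrightarrow> \<theta> w + \<theta> (- w) = s"
    unfolding constant_on_def by auto
  obtain k :: int where k: "s = 2 * pi * k"
    using s[of "axis 1 1"] sum_in[of "axis 1 1"] by auto
  define \<epsilon> :: real where "\<epsilon> = cos (pi * k)"
  have \<epsilon>: "\<epsilon> = 1 \<or> \<epsilon> = -1" and sin0: "sin (pi * k) = 0"
    unfolding \<epsilon>_def using sin_zero_iff_int2[of "pi * k"] sin_zero_abs_cos_one[of "pi * k"]
    by (auto simp: mult.commute abs_if split: if_splits)
  have "\<exists>w a. norm w = 1 \<and> u \<bullet> w = 0 \<and> fits w (of_real \<epsilon>) a" for u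
  proof -
    obtain e where e: "norm e = 1" and ue: "u = norm u *\<^sub>R e"
    proof (cases "u = 0")
      case True
      then show ?thesis using that[of "axis 1 1"] by simp
    next
      case False
      then show ?thesis using that[of "u /\<^sub>R norm u"] by (simp add: inner_commute)
    qed
    obtain v where v: "norm v = 1" "v \<bullet> e = 0" by (rule ex_unit_perp)
    \<comment> \<open>The curve runs through half of the great circle \<open>e\<^sup>\<bottom>\<close>, from \<open>v\<close> to \<open>-v\<close>.\<close>
    define c where "c t = rot e (cis t) v" for t
    have nc: "norm (c t) = 1" for t
      unfolding c_def using norm_rot[OF e _ v(2)] v(1) by simp
    have ce: "c t \<bullet> e = 0" for t
      unfolding c_def by (rule rot_perp[OF v(2)])
    have "continuous_on UNIV c"
      unfolding c_def rot_def by (intro continuous_intros)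
    then have "continuous_on {0..pi} (\<lambda>t. \<theta> (c t) - pi * k)"
      by (intro continuous_intros continuous_on_compose2[OF cont\<theta>])
         (auto simp: nc intro: continuous_on_subset)
    moreover have "\<theta> (c 0) - pi * k = - (\<theta> (c pi) - pi * k)"
    proof -
      have "c pi = - c 0" by (simp add: c_def rot_def)
      then show ?thesis using s[OF nc[of 0]] k by simp
    qed
    ultimately obtain t where t: "\<theta> (c t) - pi * k = 0"
      using IVT'[of "\<lambda>t. \<theta> (c t) - pi * k" 0 0 pi] IVT2'[of "\<lambda>t. \<theta> (c t) - pi * k" pi 0 0]
      by (metis le_cases neg_0_le_iff_le neg_le_0_iff_le pi_ge_zero)
    have "ang (c t) = of_real \<epsilon>"
      using \<theta>[OF nc[of t]] t sin0 by (simp add: \<epsilon>_def cis_conv_exp[symmetric] complex_eq_iff)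
    moreover have "u \<bullet> c t = 0"
      by (subst ue) (use ce[of t] in \<open>simp add: inner_commute\<close>)
    ultimately show ?thesis using ang_fits[OF nc[of t]] nc[of t] by metis
  qed
  then show ?thesis using that \<epsilon> by blast
qed

end

section \<open>Functions that are linear on many planes\<close>

lemma orthonormal_frame_expansion:
  fixes e e' :: "real^3"
  assumes "norm e = 1" "norm e' = 1" "e \<bullet> e' = 0"
  shows "x = (x \<bullet> e) *\<^sub>R e + (x \<bullet> e') *\<^sub>R e' + (x \<bullet> (e \<times> e')) *\<^sub>R (e \<times> e')"
proof -
  let ?p = "e \<times> e'"
  have e: "e \<bullet> e = 1" "e' \<bullet> e' = 1" "e' \<bullet> e = 0"
    using assms by (simp_all add: norm_eq_1 inner_commute)
  have p: "norm ?p = 1" using norm_cross_unit[of e e'] assms by (simp add: inner_commute)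
  have 1: "?p \<times> e = e'" "?p \<times> e' = - e"
    using assms(3) e by (simp_all add: cross_skew[of ?p] Lagrange)
  have "x \<times> ?p = (x \<bullet> e') *\<^sub>R e - (x \<bullet> e) *\<^sub>R e'" by (simp add: Lagrange)
  then have "?p \<times> (x \<times> ?p) = (x \<bullet> e) *\<^sub>R e + (x \<bullet> e') *\<^sub>R e'"
    by (simp add: Cross3.right_diff_distrib cross_mult_right 1)
  moreover have "?p \<times> (x \<times> ?p) = x - (x \<bullet> ?p) *\<^sub>R ?p"
    using p by (simp add: Lagrange[of ?p x] norm_eq_1 inner_commute)
  ultimately show ?thesis by (simp add: algebra_simps)
qed

text \<open>
  Differentiability is needed only when all the available normals \<open>w\<close> lie on one great circle. Without
  it the conclusion fails: a positively homogeneous odd function that vanishes on the axis \<open>\<real> p\<close> and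
  is linear on every plane containing it may restrict to any odd homogeneous function on \<open>p\<^sup>\<bottom>\<close>.
\<close>
lemma linear_if_linear_on_many_planes:
  fixes D :: "real^3 \<Rightarrow> real"
  assumes diff: "\<And>p. p \<noteq> 0 \<Longrightarrow> D differentiable (at p)"
    and planes: "\<And>u. \<exists>w a. norm w = 1 \<and> u \<bullet> w = 0 \<and> (\<forall>x. x \<bullet> w = 0 \<longrightarrow> D x = a \<bullet> x)"
  obtains b where "\<And>x. D x = b \<bullet> x"
proof -
  \<comment> \<open>the unit normals of the planes on which \<open>D\<close> is linear\<close>
  define Z where "Z = {w. norm w = 1 \<and> (\<exists>a. \<forall>x. x \<bullet> w = 0 \<longrightarrow> D x = a \<bullet> x)}"
  have Z: "\<exists>w\<in>Z. u \<bullet> w = 0" for u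
    using planes[of u] by (auto simp: Z_def)
  have ZI: "w \<in> Z \<Longrightarrow> norm w = 1" for w by (simp add: Z_def)
  have Z_lin: "D (s *\<^sub>R x + t *\<^sub>R y) = s * D x + t * D y"
    if w: "w \<in> Z" and xy: "x \<bullet> w = 0" "y \<bullet> w = 0" for w x y s t
  proof -
    obtain a where "\<And>x. x \<bullet> w = 0 \<Longrightarrow> D x = a \<bullet> x" using w by (auto simp: Z_def)
    then show ?thesis using xy by (simp add: inner_left_distrib inner_right_distrib)
  qed
  obtain w1 where w1: "w1 \<in> Z" using Z by blast
  obtain w2 where w2: "w2 \<in> Z" "w1 \<bullet> w2 = 0" using Z by blast
  define p where "p = w1 \<times> w2"
  have n: "norm w1 = 1" "norm w2 = 1" using w1 w2 by (auto simp: ZI)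
  have n': "w1 \<bullet> w1 = 1" "w2 \<bullet> w2 = 1" using n by (simp_all add: norm_eq_1)
  have p: "p \<bullet> w1 = 0" "p \<bullet> w2 = 0" "norm p = 1" "w1 \<bullet> p = 0" "w2 \<bullet> p = 0" "w2 \<bullet> w1 = 0"
    using norm_cross_unit[OF n] w2(2) by (auto simp: p_def dot_cross_self inner_commute)
  have pp: "p \<bullet> p = 1" using p(3) by (simp add: norm_eq_1)
  have decomp: "x = (x \<bullet> w1) *\<^sub>R w1 + (x \<bullet> w2) *\<^sub>R w2 + (x \<bullet> p) *\<^sub>R p" for x
    unfolding p_def by (rule orthonormal_frame_expansion[OF n w2(2)])
  show ?thesis
  proof (cases "\<exists>w3\<in>Z. w3 \<bullet> p \<noteq> 0")
    case True
    \<comment> \<open>three independent normals \<open>w1\<close>, \<open>w2\<close>, \<open>w3\<close>\<close>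
    then obtain w3 where w3: "w3 \<in> Z" "w3 \<bullet> p \<noteq> 0" by blast
    define b where "b = D w1 *\<^sub>R w1 + D w2 *\<^sub>R w2 + D p *\<^sub>R p"
    have b: "b \<bullet> w1 = D w1" "b \<bullet> w2 = D w2" "b \<bullet> p = D p"
      using p w2(2) by (simp_all add: b_def inner_left_distrib n' pp)
    have Db1: "D x = b \<bullet> x" if x: "x \<bullet> w1 = 0" for x
    proof -
      have e: "x = (x \<bullet> w2) *\<^sub>R w2 + (x \<bullet> p) *\<^sub>R p" using decomp[of x] x by simp
      have "D x = (x \<bullet> w2) * D w2 + (x \<bullet> p) * D p"
        by (subst e, rule Z_lin[OF w1]) (use p in auto)
      also have "\<dots> = b \<bullet> x" by (subst (3) e) (simp add: inner_right_distrib b)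
      finally show ?thesis .
    qed
    have Db2: "D x = b \<bullet> x" if x: "x \<bullet> w2 = 0" for x
    proof -
      have e: "x = (x \<bullet> w1) *\<^sub>R w1 + (x \<bullet> p) *\<^sub>R p" using decomp[of x] x by simp
      have "D x = (x \<bullet> w1) * D w1 + (x \<bullet> p) * D p"
        by (subst e, rule Z_lin[OF w2(1)]) (use p w2(2) in auto)
      also have "\<dots> = b \<bullet> x" by (subst (3) e) (simp add: inner_right_distrib b)
      finally show ?thesis .
    qed
    \<comment> \<open>On \<open>w\<^sup>\<bottom>\<close>, spanned by \<open>w \<times> w1\<close>, \<open>w \<times> w2\<close> and \<open>w \<times> w3\<close>, agreement at these three vectors suffices.\<close>
    \<comment> \<open>This is applied first with \<open>w = w3\<close>, where the last of them is zero, and then with arbitrary \<open>w\<close>.\<close>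
    have Db: "D x = b \<bullet> x"
      if w: "w \<in> Z" and x: "x \<bullet> w = 0" and w3w: "D (w \<times> w3) = b \<bullet> (w \<times> w3)" for w x
    proof -
      define y where "y = x \<times> w"
      define c where "c = (y \<bullet> p) / (w3 \<bullet> p)"
      define c1 where "c1 = y \<bullet> w1 - c * (w3 \<bullet> w1)"
      define c2 where "c2 = y \<bullet> w2 - c * (w3 \<bullet> w2)"
      have "c1 *\<^sub>R w1 + c2 *\<^sub>R w2 + c *\<^sub>R w3
        = c1 *\<^sub>R w1 + c2 *\<^sub>R w2 + c *\<^sub>R ((w3 \<bullet> w1) *\<^sub>R w1 + (w3 \<bullet> w2) *\<^sub>R w2 + (w3 \<bullet> p) *\<^sub>R p)"
        using decomp[of w3] by simp
      also have "\<dots> = (y \<bullet> w1) *\<^sub>R w1 + (y \<bullet> w2) *\<^sub>R w2 + (y \<bullet> p) *\<^sub>R p"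
        using w3(2) by (simp add: c1_def c2_def c_def algebra_simps)
      also have "\<dots> = y" using decomp[of y] by simp
      finally have y: "y = c1 *\<^sub>R w1 + c2 *\<^sub>R w2 + c *\<^sub>R w3" ..
      let ?t = "c1 *\<^sub>R (w \<times> w1) + c2 *\<^sub>R (w \<times> w2)"
      have "x = w \<times> y"
        unfolding y_def by (rule perp_eq_cross[OF ZI[OF w] x])
      then have x_eq: "x = 1 *\<^sub>R ?t + c *\<^sub>R (w \<times> w3)"
        by (simp add: y cross_add_right cross_mult_right)
      have perp: "(w \<times> v) \<bullet> w = 0" for v by (simp add: dot_cross_self inner_commute)
      have "D ?t = c1 * D (w \<times> w1) + c2 * D (w \<times> w2)"
        by (rule Z_lin[OF w perp perp])
      also have "\<dots> = b \<bullet> ?t"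
        using Db1[of "w \<times> w1"] Db2[of "w \<times> w2"] by (simp add: dot_cross_self inner_right_distrib)
      finally have t: "D ?t = b \<bullet> ?t" .
      have "D x = 1 * D ?t + c * D (w \<times> w3)"
        by (subst x_eq, rule Z_lin[OF w]) (simp_all add: inner_left_distrib perp)
      then show ?thesis
        by (subst (2) x_eq) (simp add: t w3w inner_right_distrib)
    qed
    have D0: "D 0 = 0" using Db1[of 0] by simp
    have "D x = b \<bullet> x" for x
    proof -
      have Db3: "D x = b \<bullet> x" if x: "x \<bullet> w3 = 0" for x
        by (rule Db[OF w3(1) x]) (simp add: D0)
      obtain w where w: "w \<in> Z" "x \<bullet> w = 0" using Z by blast
      show ?thesis
        by (rule Db[OF w], rule Db3) (simp add: dot_cross_self)
    qed
    then show ?thesis by (rule that)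
  next
    case False
    \<comment> \<open>All normals lie in \<open>p\<^sup>\<bottom>\<close>.\<close>
    then have Zp: "w \<bullet> p = 0" if "w \<in> Z" for w using that by blast
    \<comment> \<open>Some normal is orthogonal to \<open>p \<times> v\<close>; being orthogonal to \<open>p\<close> as well, it can only be \<open>v\<close> or \<open>-v\<close>.\<close>
    have circ: "v \<in> Z" if v: "norm v = 1" "v \<bullet> p = 0" for v
    proof -
      obtain w where w: "w \<in> Z" "(p \<times> v) \<bullet> w = 0" using Z by blast
      have "w = (w \<bullet> v) *\<^sub>R v"
        using orthonormal_frame_expansion[OF p(3) v(1), of w] v(2) Zp[OF w(1)] w(2)
        by (simp add: inner_commute)
      moreover from this have "\<bar>w \<bullet> v\<bar> = 1"
        using v(1) ZI[OF w(1)] by (metis mult.right_neutral norm_scaleR)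
      ultimately have "w = v \<or> w = - v"
        by (metis abs_eq_iff' abs_1 scaleR_minus1_left scaleR_one)
      then show ?thesis using w(1) by (auto simp: Z_def)
    qed
    have lin: "D (s *\<^sub>R p + t *\<^sub>R q) = s * D p + t * D q" if q: "q \<bullet> p = 0" for s t q
    proof -
      obtain v where v: "norm v = 1" "v \<bullet> p = 0" "v \<bullet> q = 0"
      proof (cases "q = 0")
        case True
        then show ?thesis using that n(1) p by auto
      next
        case False
        define e where "e = q /\<^sub>R norm q"
        have e: "norm e = 1" "e \<bullet> p = 0" "q = norm q *\<^sub>R e" using False q by (auto simp: e_def)
        show ?thesis
        proof (rule that)
          show "norm (p \<times> e) = 1" by (rule norm_cross_unit[OF p(3) e(1,2)])
          show "(p \<times> e) \<bullet> p = 0" by (simp add: dot_cross_self)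
          show "(p \<times> e) \<bullet> q = 0" by (subst e(3)) (simp add: dot_cross_self)
        qed
      qed
      have "v \<in> Z" using circ v by blast
      then show ?thesis using Z_lin[of v p q] v by (simp add: inner_commute)
    qed
    obtain D' where D': "(D has_derivative D') (at p)"
      using diff[of p] p(3) unfolding differentiable_def by force
    \<comment> \<open>The function \<open>t \<mapsto> D (p + t q)\<close> is affine with slope \<open>D q\<close>, which is thus the derivative of \<open>D\<close> at \<open>p\<close>.\<close>
    have D'q: "D q = D' q" if q: "q \<bullet> p = 0" for q
    proof -
      have "((\<lambda>t. D (p + t *\<^sub>R q)) has_derivative (\<lambda>t. D' (t *\<^sub>R q))) (at 0)"
        by (rule has_derivative_compose[where g = D and f = "\<lambda>t. p + t *\<^sub>R q" and x = 0, simplified, OF _ D'])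
           (auto intro!: derivative_eq_intros)
      moreover have "(\<lambda>t. D (p + t *\<^sub>R q)) = (\<lambda>t. D p + t * D q)"
        using lin[OF q, of 1] by auto
      moreover have "((\<lambda>t. D p + t * D q) has_derivative (\<lambda>t. t * D q)) (at 0)"
        by (auto intro!: derivative_eq_intros)
      ultimately have "(\<lambda>t. D' (t *\<^sub>R q)) = (\<lambda>t. t * D q)"
        using has_derivative_unique by metis
      from fun_cong[OF this, of 1] show ?thesis by simp
    qed
    have linD': "linear D'" using D' by (simp add: has_derivative_linear)
    define b where "b = D p *\<^sub>R p + D' w1 *\<^sub>R w1 + D' w2 *\<^sub>R w2"
    have "D x = b \<bullet> x" for x
    proof -
      let ?q = "(x \<bullet> w1) *\<^sub>R w1 + (x \<bullet> w2) *\<^sub>R w2"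
      have q: "?q \<bullet> p = 0" using p by (simp add: inner_left_distrib)
      have "D x = D ((x \<bullet> p) *\<^sub>R p + 1 *\<^sub>R ?q)" using decomp[of x] by (simp add: add_ac)
      also have "\<dots> = (x \<bullet> p) * D p + D' ?q" using lin[OF q, of "x \<bullet> p" 1] D'q[OF q] by simp
      also have "\<dots> = b \<bullet> x"
        by (simp add: b_def linear_add[OF linD'] linear_cmul[OF linD'] inner_left_distrib inner_commute[of _ x] inner_right_distrib mult_ac)
      finally show ?thesis .
    qed
    then show ?thesis by (rule that)
  qed
qed

lemma (in circlewise_congruent) congruent_globally:
  assumes "\<And>p. p \<noteq> 0 \<Longrightarrow> F differentiable (at p)" "\<And>p. p \<noteq> 0 \<Longrightarrow> G differentiable (at p)"
  obtains \<epsilon> :: real and b where "\<epsilon> = 1 \<or> \<epsilon> = -1" "\<And>x. G x = F (\<epsilon> *\<^sub>R x) + b \<bullet> x"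
proof -
  obtain \<epsilon> :: real where \<epsilon>: "\<epsilon> = 1 \<or> \<epsilon> = -1"
    and Z: "\<And>u. \<exists>w a. norm w = 1 \<and> u \<bullet> w = 0 \<and> fits w (of_real \<epsilon>) a"
    using ex_sign by blast
  have "\<exists>w a. norm w = 1 \<and> u \<bullet> w = 0 \<and> (\<forall>x. x \<bullet> w = 0 \<longrightarrow> G x - F (\<epsilon> *\<^sub>R x) = a \<bullet> x)" for u
  proof -
    obtain w a where "norm w = 1" "u \<bullet> w = 0" "fits w (of_real \<epsilon>) a" using Z by blast
    then show ?thesis
      by (intro exI[of _ w] exI[of _ a]) (auto simp: fits_def rot_of_real algebra_simps)
  qed
  moreover have "(\<lambda>x. G x - F (\<epsilon> *\<^sub>R x)) differentiable (at p)" if p: "p \<noteq> 0" for p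
  proof (rule differentiable_diff[OF assms(2)[OF p]])
    have "(\<lambda>x. \<epsilon> *\<^sub>R x) differentiable (at p)" by (intro derivative_intros)
    moreover have "F differentiable (at (\<epsilon> *\<^sub>R p))" using \<epsilon> p by (intro assms) auto
    ultimately show "(\<lambda>x. F (\<epsilon> *\<^sub>R x)) differentiable (at p)"
      using differentiable_chain_at[of "\<lambda>x. \<epsilon> *\<^sub>R x" p F] by (simp add: o_def)
  qed
  ultimately obtain b where "\<And>x. G x - F (\<epsilon> *\<^sub>R x) = b \<bullet> x"
    using linear_if_linear_on_many_planes by blast
  then have "G x = F (\<epsilon> *\<^sub>R x) + b \<bullet> x" for x by (metis add.commute diff_add_cancel)
  then show ?thesis using that \<epsilon> by blast
qed

section \<open>Homogeneous extension of functions on the sphere\<close>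

text \<open>
  The extension of a function on the unit sphere to a positively homogeneous function of degree one
  on the whole space. It is the natural choice here because adding \<open>a \<bullet> u\<close> on the sphere corresponds
  to adding \<open>a \<bullet> x\<close> on the space.
\<close>
definition radial_ext :: "('a::real_normed_vector \<Rightarrow> real) \<Rightarrow> 'a \<Rightarrow> real" where
  "radial_ext f x = norm x * f (sgn x)"

lemma radial_ext_unit: "norm x = 1 \<Longrightarrow> radial_ext f x = f x"
  by (simp add: radial_ext_def sgn_div_norm)

lemma radial_ext_zero [simp]: "radial_ext f 0 = 0"
  by (simp add: radial_ext_def)

lemma radial_ext_scaleR: "c \<ge> 0 \<Longrightarrow> radial_ext f (c *\<^sub>R x) = c * radial_ext f x"
  by (cases "c = 0") (simp_all add: radial_ext_def sgn_scaleR)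

lemma differentiable_radial_ext:
  fixes f :: "'a::euclidean_space \<Rightarrow> real"
  assumes f: "C2_on_sphere f" and p: "p \<noteq> 0"
  shows "radial_ext f differentiable (at p)"
proof -
  have "sgn p \<in> sphere 0 1" using p by (simp add: norm_sgn)
  then obtain U F where U: "open U" "sgn p \<in> U" "C2_on U F"
    and Ff: "\<And>x. x \<in> U \<inter> sphere 0 1 \<Longrightarrow> F x = f x"
    using f unfolding C2_on_sphere_def by metis
  have F: "F differentiable (at (sgn p))"
    using U(2,3) unfolding C2_on_def differentiable_def by blast
  have norm_diff: "norm differentiable (at p)"
    using p by (rule differentiable_norm_at)
  have "(\<lambda>x. inverse (norm x) *\<^sub>R x) differentiable (at p)"
    using p norm_diff by (intro derivative_intros) auto
  then have sgn_diff: "sgn differentiable (at p)"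
    by (simp add: sgn_div_norm[abs_def])
  have "(\<lambda>x. F (sgn x)) differentiable (at p)"
    using differentiable_chain_at[OF sgn_diff F] by (simp add: o_def)
  with norm_diff have *: "(\<lambda>x. norm x * F (sgn x)) differentiable (at p)"
    by (intro differentiable_mult)
  have "(sgn \<longlongrightarrow> sgn p) (at p)"
    using p by (intro tendsto_intros)
  then have "\<forall>\<^sub>F x in at p. sgn x \<in> U" using U(1,2) by (rule topological_tendstoD)
  moreover have "\<forall>\<^sub>F x in at p. x \<noteq> 0"
    using p tendsto_imp_eventually_ne[OF tendsto_ident_at] by blast
  ultimately have "\<forall>\<^sub>F x in at p. norm x * F (sgn x) = radial_ext f x"
    by eventually_elim (simp add: radial_ext_def Ff norm_sgn)
  moreover have "norm p * F (sgn p) = radial_ext f p"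
    using U(2) p by (simp add: radial_ext_def Ff norm_sgn)
  ultimately show ?thesis
    using * unfolding differentiable_def by (metis has_derivative_transform_eventually UNIV_I)
qed

lemma continuous_radial_ext:
  fixes f :: "'a::euclidean_space \<Rightarrow> real"
  assumes f: "C2_on_sphere f"
  shows "continuous_on UNIV (radial_ext f)"
proof -
  have *: "isCont (radial_ext f) p" if "p \<noteq> 0" for p
    using differentiable_radial_ext[OF f that] differentiable_imp_continuous_within by blast
  have "continuous_on (sphere 0 1) (radial_ext f)"
    by (intro continuous_at_imp_continuous_on ballI *) auto
  then have "compact (radial_ext f ` sphere 0 1)" by (intro compact_continuous_image) auto
  then obtain B where "\<forall>y \<in> radial_ext f ` sphere 0 1. norm y \<le> B"
    using compact_imp_bounded bounded_iff by metis
  then have B: "\<And>x. norm x = 1 \<Longrightarrow> norm (radial_ext f x) \<le> B" by simp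
  have "norm (radial_ext f x) \<le> B * norm x" for x
  proof (cases "x = 0")
    case False
    then have n: "norm (sgn x) = 1" by (simp add: norm_sgn)
    then have "\<bar>f (sgn x)\<bar> \<le> B" using B[OF n] by (simp add: radial_ext_unit)
    then show ?thesis by (simp add: abs_mult radial_ext_def mult.commute[of B] mult_left_mono)
  qed simp
  then have "(radial_ext f \<longlongrightarrow> 0) (at 0)"
    using Lim_null_comparison[OF _ tendsto_mult_right_zero[OF tendsto_norm_zero[OF tendsto_ident_at]]]
    by (metis (mono_tags, lifting) always_eventually)
  then have "isCont (radial_ext f) 0" by (simp add: isCont_def)
  with * show ?thesis by (metis continuous_at_imp_continuous_on)
qed

section \<open>Isometric copies of three-space\<close>

text \<open>
  An isometric linear embedding of three-space, by which a three-dimensional subspace of \<open>'a\<close> and its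
  planes are described through the cross product.
\<close>
locale isometric_embedding3 =
  fixes L :: "real^3 \<Rightarrow> 'a::euclidean_space"
  assumes linL: "linear L" and normL: "\<And>x. norm (L x) = norm x"
begin

lemma inner_L: "L x \<bullet> L y = x \<bullet> y"
  using normL by (simp add: dot_norm linear_add[OF linL, symmetric])

lemma inj_L: "inj L"
  using linL normL by (metis linear_injective_0 norm_eq_zero)

text \<open>
  The image of the plane orthogonal to \<open>w\<close>.
\<close>
definition perp_plane :: "real^3 \<Rightarrow> 'a set" where
  "perp_plane w = L ` {u. u \<bullet> w = 0}"

lemma perp_plane:
  assumes w: "norm w = 1"
  shows "plane_through_origin (perp_plane w)"
proof -
  have "dim {u. u \<bullet> w = 0} = 2"
    using w dim_hyperplane[of w] by (cases "w = 0") (simp_all add: inner_commute)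
  then have "dim (perp_plane w) = 2"
    unfolding perp_plane_def using dim_image_eq[OF linL] inj_L by (metis inj_on_subset subset_UNIV)
  moreover have "subspace (perp_plane w)"
    unfolding perp_plane_def by (intro linear_subspace_image linL) (auto simp: subspace_hyperplane2)
  ultimately show ?thesis by (simp add: plane_through_origin_def)
qed

text \<open>
  An element of \<open>SO2\<close> is given in terms of some orthonormal frame, whose orientation need not agree
  with that defined by \<open>w\<close>; the sign \<open>\<sigma>\<close> in the proof compares the two.
\<close>
lemma SO2_imp_rot:
  assumes w: "norm w = 1" and \<phi>: "\<phi> \<in> SO2 (perp_plane w)"
  obtains z where "norm z = 1" "\<And>u. u \<bullet> w = 0 \<Longrightarrow> \<phi> (L u) = L (rot w z u)"
proof -
  let ?P = "perp_plane w"
  have \<phi>_in: "\<And>x. x \<in> ?P \<Longrightarrow> \<phi> x \<in> ?P"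
    and \<phi>_add: "\<And>x y. x \<in> ?P \<Longrightarrow> y \<in> ?P \<Longrightarrow> \<phi> (x + y) = \<phi> x + \<phi> y"
    and \<phi>_scale: "\<And>c x. x \<in> ?P \<Longrightarrow> \<phi> (c *\<^sub>R x) = c *\<^sub>R \<phi> x"
    and \<phi>_inner: "\<And>x y. x \<in> ?P \<Longrightarrow> y \<in> ?P \<Longrightarrow> \<phi> x \<bullet> \<phi> y = x \<bullet> y"
    using \<phi> by (auto simp: SO2_def)
  obtain e where e: "\<And>i j. e i \<bullet> e j = (if i = j then 1 else 0)" "span (range e) = ?P"
    and det: "det ((\<chi> i j. e i \<bullet> \<phi> (e j)) :: real ^ 2 ^ 2) = 1"
    using \<phi> by (auto simp: SO2_def orthonormal_frame_def)
  have eP: "e i \<in> ?P" for i using e(2) span_base[of "e i" "range e"] by auto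
  obtain e1 where e1: "e 1 = L e1" "e1 \<bullet> w = 0" using eP[of 1] by (auto simp: perp_plane_def)
  obtain e2 where e2: "e 2 = L e2" "e2 \<bullet> w = 0" using eP[of 2] by (auto simp: perp_plane_def)
  have n1: "norm e1 = 1" and n2: "norm e2 = 1" and e12: "e1 \<bullet> e2 = 0"
    using e(1)[of 1 1] e(1)[of 2 2] e(1)[of 1 2] e1 e2 by (auto simp: inner_L norm_eq_1)
  let ?f = "w \<times> e1"
  define \<sigma> where "\<sigma> = e2 \<bullet> ?f"
  have e2f: "e2 = \<sigma> *\<^sub>R ?f"
    using orthonormal_frame_expansion[OF w n1, of e2] e1 e2 e12 by (simp add: inner_commute \<sigma>_def)
  have nf: "norm ?f = 1" by (rule norm_cross_unit[OF w n1 e1(2)])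
  have \<sigma>1: "\<bar>\<sigma>\<bar> = 1" using e2f n2 nf by (metis mult.right_neutral norm_scaleR)
  then have \<sigma>\<sigma>: "\<sigma> * \<sigma> = 1" by (metis abs_mult_self_eq mult_1)
  have fe2: "?f = \<sigma> *\<^sub>R e2" using \<sigma>\<sigma> by (subst e2f) simp
  have expand: "u = (u \<bullet> e1) *\<^sub>R e1 + (u \<bullet> e2) *\<^sub>R e2" if u: "u \<bullet> w = 0" for u
  proof -
    have "u = (u \<bullet> e1) *\<^sub>R e1 + (u \<bullet> ?f) *\<^sub>R ?f"
      using orthonormal_frame_expansion[OF w n1, of u] e1 u by (simp add: inner_commute)
    also have "(u \<bullet> ?f) *\<^sub>R ?f = (\<sigma> * \<sigma> * (u \<bullet> e2)) *\<^sub>R e2" by (simp add: fe2 mult_ac)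
    finally show ?thesis by (simp add: \<sigma>\<sigma>)
  qed
  obtain p where p: "\<phi> (e 1) = L p" "p \<bullet> w = 0" using \<phi>_in[OF eP] by (auto simp: perp_plane_def)
  obtain q where q: "\<phi> (e 2) = L q" "q \<bullet> w = 0" using \<phi>_in[OF eP] by (auto simp: perp_plane_def)
  define c where "c = p \<bullet> e1"
  define s where "s = p \<bullet> e2"
  define c' where "c' = q \<bullet> e1"
  define s' where "s' = q \<bullet> e2"
  have pe: "p = c *\<^sub>R e1 + s *\<^sub>R e2" and qe: "q = c' *\<^sub>R e1 + s' *\<^sub>R e2"
    unfolding c_def s_def c'_def s'_def by (rule expand[OF p(2)], rule expand[OF q(2)])
  have "p \<bullet> p = 1" "q \<bullet> q = 1"
    using \<phi>_inner[OF eP eP] e(1) p q by (metis inner_L)+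
  then have r: "c * c + s * s = 1" "c' * c' + s' * s' = 1"
    using n1 n2 e12 by (simp_all add: pe qe inner_left_distrib inner_right_distrib norm_eq_1 inner_commute)
  have d: "c * s' - c' * s = 1"
    using det p(1) q(1) unfolding e1 e2 by (simp add: det_2 e1(1) e2(1) inner_L c_def s_def c'_def s'_def inner_commute)
  \<comment> \<open>Expanding gives the two squared column lengths minus twice the determinant, which is \<open>1 + 1 - 2\<close>.\<close>
  have "(c - s') * (c - s') + (s + c') * (s + c') = 0"
    using r d by (simp add: algebra_simps)
  then have cs: "s' = c" "c' = - s" by (auto simp: sum_squares_eq_zero_iff)
  define z where "z = Complex c (\<sigma> * s)"
  have rot1: "rot w z e1 = p"
    using \<sigma>\<sigma> by (simp add: rot_def z_def pe fe2 mult.commute mult.left_commute)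
  have we2: "w \<times> e2 = - \<sigma> *\<^sub>R e1"
    by (subst e2f) (simp add: cross_mult_right cross_cross_perp[OF w e1(2)])
  have rot2: "rot w z e2 = q"
    using \<sigma>\<sigma> by (simp add: rot_def z_def qe cs we2 mult.commute mult.left_commute)
  show ?thesis
  proof (rule that[of z])
    have "(\<sigma> * s) * (\<sigma> * s) = (\<sigma> * \<sigma>) * (s * s)" by (simp only: mult_ac)
    then have "(\<sigma> * s) * (\<sigma> * s) = s * s" by (simp only: \<sigma>\<sigma> mult_1)
    then have "c * c + (\<sigma> * s) * (\<sigma> * s) = 1" using r(1) by (simp only:)
    then show "norm z = 1" by (simp add: z_def complex_norm power2_eq_square)
    fix u assume u: "u \<bullet> w = 0"
    let ?x = "u \<bullet> e1" and ?y = "u \<bullet> e2"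
    have sc: "c *\<^sub>R e i \<in> ?P" for c i
      using eP perp_plane[OF w] by (simp add: plane_through_origin_def subspace_scale)
    have "\<phi> (L u) = \<phi> (?x *\<^sub>R e 1 + ?y *\<^sub>R e 2)"
      by (subst expand[OF u]) (simp add: linear_add[OF linL] linear_cmul[OF linL] e1 e2)
    also have "\<dots> = ?x *\<^sub>R L p + ?y *\<^sub>R L q"
      by (simp add: \<phi>_add sc \<phi>_scale eP p q)
    also have "\<dots> = L (?x *\<^sub>R rot w z e1 + ?y *\<^sub>R rot w z e2)"
      by (simp add: linear_add[OF linL] linear_cmul[OF linL] rot1 rot2)
    also have "?x *\<^sub>R rot w z e1 + ?y *\<^sub>R rot w z e2 = rot w z (?x *\<^sub>R e1 + ?y *\<^sub>R e2)"
      by (simp add: rot_def cross_add_right cross_mult_right algebra_simps)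
    also have "?x *\<^sub>R e1 + ?y *\<^sub>R e2 = u" using expand[OF u] by simp
    finally show "\<phi> (L u) = L (rot w z u)" .
  qed
qed

lemma rot_in_SO2:
  assumes w: "norm w = 1" and z: "norm z = 1"
  obtains \<phi> where "\<phi> \<in> SO2 (perp_plane w)" "\<And>u. u \<bullet> w = 0 \<Longrightarrow> \<phi> (L u) = L (rot w z u)"
proof -
  define \<phi> where "\<phi> x = L (rot w z (inv L x))" for x
  have \<phi>L: "\<phi> (L u) = L (rot w z u)" for u by (simp add: \<phi>_def inv_f_f[OF inj_L])
  have add: "\<phi> (L u + L v) = \<phi> (L u) + \<phi> (L v)" for u v
    unfolding linear_add[OF linL, symmetric] \<phi>L by (simp add: rot_def cross_add_right algebra_simps)
  have scale: "\<phi> (c *\<^sub>R L u) = c *\<^sub>R \<phi> (L u)" for c u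
    unfolding linear_cmul[OF linL, symmetric] \<phi>L by (simp add: rot_def cross_mult_right algebra_simps)
  obtain v where v: "norm v = 1" "v \<bullet> w = 0" by (rule ex_unit_perp)
  let ?f = "w \<times> v"
  have f: "norm ?f = 1" by (rule norm_cross_unit[OF w v])
  have ip: "v \<bullet> v = 1" "?f \<bullet> ?f = 1" "v \<bullet> ?f = 0" "?f \<bullet> v = 0" "?f \<bullet> w = 0"
    using v f by (simp_all add: norm_eq_1 dot_cross_self)
  define e :: "2 \<Rightarrow> 'a" where "e i = (if i = 1 then L v else L ?f)" for i
  have "range e = {L v, L ?f}"
    by (auto simp: UNIV_2 e_def)
  moreover have "span {L v, L ?f} = perp_plane w"
  proof
    have "L v \<in> perp_plane w" "L ?f \<in> perp_plane w" using v ip by (auto simp: perp_plane_def)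
    then show "span {L v, L ?f} \<subseteq> perp_plane w"
      using perp_plane[OF w] by (intro span_minimal) (auto simp: plane_through_origin_def)
    show "perp_plane w \<subseteq> span {L v, L ?f}"
    proof
      fix x assume "x \<in> perp_plane w"
      then obtain u where u: "x = L u" "u \<bullet> w = 0" by (auto simp: perp_plane_def)
      have "u = (u \<bullet> v) *\<^sub>R v + (u \<bullet> ?f) *\<^sub>R ?f"
        using orthonormal_frame_expansion[OF w v(1), of u] v u by (simp add: inner_commute)
      then have "x = (u \<bullet> v) *\<^sub>R L v + (u \<bullet> ?f) *\<^sub>R L ?f"
        unfolding u(1) by (metis linear_add[OF linL] linear_cmul[OF linL])
      then show "x \<in> span {L v, L ?f}"
        by (simp add: span_add span_scale span_base)
    qed
  qed
  ultimately have frame: "orthonormal_frame (perp_plane w) e"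
    using ip by (auto simp: orthonormal_frame_def e_def inner_L) (metis exhaust_2)
  have r: "rot w z v = Re z *\<^sub>R v + Im z *\<^sub>R ?f" "rot w z ?f = Re z *\<^sub>R ?f - Im z *\<^sub>R v"
    using cross_cross_perp[OF w v(2)] by (simp_all add: rot_def)
  have z': "Re z * Re z + Im z * Im z = 1"
    using z cmod_power2[of z] by (simp add: power2_eq_square)
  have det: "det ((\<chi> i j. e i \<bullet> \<phi> (e j)) :: real ^ 2 ^ 2) = 1"
    using z' ip by (simp add: det_2 e_def \<phi>L inner_L r inner_right_distrib inner_diff_right)
  have "\<phi> \<in> SO2 (perp_plane w)"
    unfolding SO2_def
  proof (intro CollectI conjI)
    show "\<phi> ` perp_plane w \<subseteq> perp_plane w" by (auto simp: perp_plane_def \<phi>L intro: rot_perp)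
    show "\<forall>x\<in>perp_plane w. \<forall>y\<in>perp_plane w. \<phi> (x + y) = \<phi> x + \<phi> y" by (auto simp: perp_plane_def add)
    show "\<forall>c. \<forall>x\<in>perp_plane w. \<phi> (c *\<^sub>R x) = c *\<^sub>R \<phi> x" by (auto simp: perp_plane_def scale)
    show "\<forall>x\<in>perp_plane w. \<forall>y\<in>perp_plane w. \<phi> x \<bullet> \<phi> y = x \<bullet> y"
      by (auto simp: perp_plane_def \<phi>L inner_L inner_rot_rot[OF w z])
    show "\<exists>e. orthonormal_frame (perp_plane w) e \<and> det ((\<chi> i j. e i \<bullet> \<phi> (e j)) :: real ^ 2 ^ 2) = 1"
      using frame det by blast
  qed
  then show ?thesis using that \<phi>L by blast
qed

lemma circlewise_congruent_radial_ext:
  fixes f g :: "'a \<Rightarrow> real"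
  assumes f: "C2_on_sphere f" and g: "C2_on_sphere g"
    and cong: "\<And>\<alpha>. plane_through_origin \<alpha> \<Longrightarrow>
           \<exists>a\<in>\<alpha>. \<exists>\<phi>\<in>SO2 \<alpha>. \<forall>u\<in>sphere 0 1 \<inter> \<alpha>. f (\<phi> u) + a \<bullet> u = g u"
    and rigid: "\<And>\<alpha>. plane_through_origin \<alpha> \<Longrightarrow> \<not> direct_rigid_motion_symmetry \<alpha> f"
  shows "circlewise_congruent (radial_ext f \<circ> L) (radial_ext g \<circ> L)"
proof
  have cL: "continuous_on UNIV L" using linL by (simp add: linear_continuous_on linear_conv_bounded_linear)
  show "continuous_on UNIV (radial_ext f \<circ> L)" "continuous_on UNIV (radial_ext g \<circ> L)"
    using continuous_on_compose2[OF continuous_radial_ext cL] f g by (auto simp: o_def)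
  have hom: "(radial_ext h \<circ> L) (rot w z u) = norm u * (radial_ext h \<circ> L) (rot w z (sgn u))" for h :: "'a \<Rightarrow> real" and w z u
  proof -
    have "L (rot w z u) = norm u *\<^sub>R L (rot w z (sgn u))"
      by (cases "u = 0") (auto simp: rot_def linear_add[OF linL] linear_cmul[OF linL] sgn_div_norm
          cross_mult_right linear_0[OF linL] algebra_simps)
    then show ?thesis by (simp add: radial_ext_scaleR)
  qed
  fix w :: "real^3" assume w: "norm w = 1"
  show "\<exists>z a. norm z = 1 \<and> (\<forall>u. u \<bullet> w = 0 \<longrightarrow>
           (radial_ext f \<circ> L) (rot w z u) + a \<bullet> u = (radial_ext g \<circ> L) u)"
  proof -
    obtain a \<phi> where a: "a \<in> perp_plane w" and \<phi>: "\<phi> \<in> SO2 (perp_plane w)"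
      and fg: "\<And>u. u \<in> sphere 0 1 \<inter> perp_plane w \<Longrightarrow> f (\<phi> u) + a \<bullet> u = g u"
      using cong[OF perp_plane[OF w]] by metis
    obtain a' where a': "a = L a'" using a by (auto simp: perp_plane_def)
    obtain z where z: "norm z = 1" "\<And>u. u \<bullet> w = 0 \<Longrightarrow> \<phi> (L u) = L (rot w z u)"
      using SO2_imp_rot[OF w \<phi>] by blast
    have unit: "(radial_ext f \<circ> L) (rot w z u) + a' \<bullet> u = (radial_ext g \<circ> L) u"
      if u: "norm u = 1" "u \<bullet> w = 0" for u
      using fg[of "L u"] u z norm_rot[OF w z(1) u(2)]
      by (auto simp: normL radial_ext_unit a' inner_L perp_plane_def)
    have "(radial_ext f \<circ> L) (rot w z u) + a' \<bullet> u = (radial_ext g \<circ> L) u"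
      if u: "u \<bullet> w = 0" for u
    proof (cases "u = 0")
      case True
      then show ?thesis by (simp add: rot_def linear_0[OF linL])
    next
      case False
      have "u = norm u *\<^sub>R sgn u" using False by (simp add: sgn_div_norm)
      then have *: "a' \<bullet> u = norm u * (a' \<bullet> sgn u)" by (metis inner_scaleR_right)
      have "norm (sgn u) = 1" "sgn u \<bullet> w = 0" using False u by (simp_all add: norm_sgn) (simp add: sgn_div_norm)
      then show ?thesis
        using unit[of "sgn u"] hom[of f w z u] hom[of g w 1 u] * by (simp add: distrib_left[symmetric])
    qed
    then show ?thesis using z(1) by blast
  qed
  fix z a assume z: "norm z = 1"
    and sym: "\<And>u. u \<bullet> w = 0 \<Longrightarrow> (radial_ext f \<circ> L) (rot w z u) + a \<bullet> u = (radial_ext f \<circ> L) u"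
  show "z = 1"
  proof (rule ccontr)
    assume "z \<noteq> 1"
    obtain \<phi> where \<phi>: "\<phi> \<in> SO2 (perp_plane w)" and \<phi>L: "\<And>u. u \<bullet> w = 0 \<Longrightarrow> \<phi> (L u) = L (rot w z u)"
      using rot_in_SO2[OF w z] by blast
    obtain v where v: "norm v = 1" "v \<bullet> w = 0" by (rule ex_unit_perp)
    have "\<phi> (L v) \<noteq> L v"
    proof
      assume "\<phi> (L v) = L v"
      then have "rot w z v = v" using \<phi>L[OF v(2)] inj_L by (simp add: inj_eq)
      then have "rot w z v \<bullet> v = 1" using v by (simp add: norm_eq_1)
      then have "Re z = 1" using v by (simp add: rot_def inner_left_distrib dot_cross_self norm_eq_1)
      then show False using z \<open>z \<noteq> 1\<close> by (simp add: complex_eq_iff cmod_def)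
    qed
    moreover have "L v \<in> perp_plane w" using v by (auto simp: perp_plane_def)
    moreover define c where "c = a - (a \<bullet> w) *\<^sub>R w"
    have "L c \<in> perp_plane w"
      using w by (auto simp: perp_plane_def c_def inner_diff_left norm_eq_1)
    moreover have "f (\<phi> x) + L c \<bullet> x = f x" if x: "x \<in> sphere 0 1 \<inter> perp_plane w" for x
    proof -
      obtain u where u: "x = L u" "u \<bullet> w = 0" using x by (auto simp: perp_plane_def)
      have nu: "norm u = 1" using x u by (simp add: normL)
      have "c \<bullet> u = a \<bullet> u" using u by (simp add: c_def inner_diff_left inner_commute[of w])
      then show ?thesis
        using sym[OF u(2)] u nu norm_rot[OF w z u(2)]
        by (simp add: \<phi>L normL radial_ext_unit inner_L)
    qed
    ultimately have "direct_rigid_motion_symmetry (perp_plane w) f"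
      unfolding direct_rigid_motion_symmetry_def using \<phi> by blast
    then show False using rigid perp_plane[OF w] by blast
  qed
qed

end

section \<open>Gluing the three-dimensional subspaces\<close>

lemma ex_subspace_superset_dim:
  fixes X :: "'a::euclidean_space set"
  assumes "dim X \<le> k" "k \<le> DIM('a)"
  obtains V where "subspace V" "dim V = k" "X \<subseteq> V"
proof -
  have "\<exists>V. subspace V \<and> dim V = k \<and> X \<subseteq> V"
    using assms
  proof (induction k rule: dec_induct)
    case base
    then show ?case
      by (intro exI[of _ "span X"]) (auto simp: span_base)
  next
    case (step k)
    then obtain V where V: "subspace V" "dim V = k" "X \<subseteq> V" by auto
    have "V \<noteq> UNIV" using V(2) step.prems by auto
    then obtain v where "v \<notin> span V" using V(1) by (metis UNIV_eq_I span_eq_iff)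
    then have "dim (span (insert v V)) = Suc k" by (simp add: dim_insert V(2))
    moreover have "X \<subseteq> span (insert v V)" using V(3) span_superset by blast
    ultimately show ?case by blast
  qed
  then show ?thesis using that by blast
qed

lemma plane_through_origin_span:
  assumes "x \<noteq> 0" "y \<notin> span {x}"
  shows "plane_through_origin (span {x, y})"
  using assms by (simp add: plane_through_origin_def insert_commute[of x y] dim_insert)

text \<open>
  On the set \<open>V\<close>, the function \<open>G\<close> differs from \<open>x \<mapsto> F (\<epsilon> x)\<close> by a linear functional.
\<close>
definition matches :: "('a::euclidean_space \<Rightarrow> real) \<Rightarrow> ('a \<Rightarrow> real) \<Rightarrow> real \<Rightarrow> 'a set \<Rightarrow> bool" where
  "matches F G \<epsilon> V \<longleftrightarrow> (\<exists>b. \<forall>x\<in>V. G x = F (\<epsilon> *\<^sub>R x) + b \<bullet> x)"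

lemma matches_subset: "matches F G \<epsilon> V \<Longrightarrow> W \<subseteq> V \<Longrightarrow> matches F G \<epsilon> W"
  unfolding matches_def by blast

lemma uminus_in_SO2:
  assumes "subspace \<alpha>" "orthonormal_frame \<alpha> e"
  shows "uminus \<in> SO2 \<alpha>"
proof -
  have "det ((\<chi> i j. e i \<bullet> - e j) :: real^2^2) = 1"
    using assms(2) by (simp add: det_2 orthonormal_frame_def)
  then show ?thesis
    using assms by (auto simp: SO2_def subspace_neg)
qed

text \<open>
  If both signs were possible on a plane, comparing the two relations would make the half-turn
  \<open>uminus\<close> a direct symmetry of \<open>f\<close> there.
\<close>
lemma matches_plane_sign_unique:
  assumes SO2: "uminus \<in> SO2 \<alpha>" and \<alpha>: "plane_through_origin \<alpha>" and rigid: "\<not> direct_rigid_motion_symmetry \<alpha> f"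
    and m: "matches (radial_ext f) (radial_ext g) 1 \<alpha>" "matches (radial_ext f) (radial_ext g) (-1) \<alpha>"
  shows False
proof -
  obtain b c where b: "\<And>x. x \<in> \<alpha> \<Longrightarrow> radial_ext g x = radial_ext f x + b \<bullet> x"
    and c: "\<And>x. x \<in> \<alpha> \<Longrightarrow> radial_ext g x = radial_ext f (- x) + c \<bullet> x"
    using m unfolding matches_def scaleR_one scaleR_minus1_left by blast
  have sub: "subspace \<alpha>" and dim: "dim \<alpha> = 2" using \<alpha> by (auto simp: plane_through_origin_def)
  obtain p where p: "p \<in> \<alpha>" "p \<noteq> 0"
    using dim by (metis dim_eq_0 subsetI singletonI zero_neq_numeral)
  \<comment> \<open>The vector \<open>c - b\<close> need not lie in \<open>\<alpha>\<close>; its orthogonal projection to \<open>\<alpha>\<close> does.\<close>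
  obtain a where a: "a \<in> \<alpha>" "\<And>x. x \<in> \<alpha> \<Longrightarrow> a \<bullet> x = (c - b) \<bullet> x"
  proof -
    obtain y z where "y \<in> span \<alpha>" "\<And>x. x \<in> span \<alpha> \<Longrightarrow> orthogonal z x" "c - b = y + z"
      using orthogonal_subspace_decomp_exists by blast
    then show ?thesis
      using that[of y] sub by (auto simp: span_eq_iff[THEN iffD2] orthogonal_def inner_left_distrib)
  qed
  have "f (- u) + a \<bullet> u = f u" if "u \<in> sphere 0 1 \<inter> \<alpha>" for u
    using that b[of u] c[of u] a(2)[of u] by (simp add: radial_ext_unit inner_diff_left)
  moreover have "- p \<noteq> p"
  proof
    assume "- p = p"
    then have "p + p = 0" by (metis add.left_inverse)
    then show False using p(2) by (simp add: scaleR_2[symmetric])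
  qed
  ultimately have "direct_rigid_motion_symmetry \<alpha> f"
    unfolding direct_rigid_motion_symmetry_def
    by (intro bexI[OF _ SO2] bexI[OF _ a(1)] conjI bexI[OF _ p(1)] ballI) simp_all
  then show False using rigid by blast
qed

lemma ex_matching_sign:
  assumes f: "C2_on_sphere f" and g: "C2_on_sphere g"
    and cong: "\<And>\<alpha>. plane_through_origin \<alpha> \<Longrightarrow>
           \<exists>a\<in>\<alpha>. \<exists>\<phi>\<in>SO2 \<alpha>. \<forall>u\<in>sphere 0 1 \<inter> \<alpha>. f (\<phi> u) + a \<bullet> u = g u"
    and rigid: "\<And>\<alpha>. plane_through_origin \<alpha> \<Longrightarrow> \<not> direct_rigid_motion_symmetry \<alpha> f"
    and V: "subspace V" "dim V = 3"
  shows "\<exists>\<epsilon>. (\<epsilon> = 1 \<or> \<epsilon> = -1) \<and> matches (radial_ext f) (radial_ext g) \<epsilon> V"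
proof -
  obtain L :: "real^3 \<Rightarrow> 'a" where L: "linear L" "range L = V" "\<And>x. norm (L x) = norm x"
    using isometry_subspaces[of "UNIV :: (real^3) set" V] V by auto
  interpret isometric_embedding3 L by (rule isometric_embedding3.intro) (use L in blast)+
  interpret circlewise_congruent "radial_ext f \<circ> L" "radial_ext g \<circ> L"
    by (rule circlewise_congruent_radial_ext[OF f g cong rigid])
  have dL: "L differentiable (at p)" for p
    using L(1) by (simp add: linear_imp_differentiable)
  have diff: "(radial_ext h \<circ> L) differentiable (at p)" if "C2_on_sphere h" "p \<noteq> 0" for h p
  proof (rule differentiable_chain_at[OF dL differentiable_radial_ext[OF that(1)]])
    show "L p \<noteq> 0" using that(2) normL[of p] by force
  qed
  obtain \<epsilon> b where \<epsilon>: "\<epsilon> = 1 \<or> \<epsilon> = -1"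
    and b: "\<And>x. (radial_ext g \<circ> L) x = (radial_ext f \<circ> L) (\<epsilon> *\<^sub>R x) + b \<bullet> x"
    using congruent_globally diff f g by metis
  have "matches (radial_ext f) (radial_ext g) \<epsilon> V"
    unfolding matches_def L(2)[symmetric]
    using b by (intro exI[of _ "L b"]) (auto simp: inner_L linear_cmul[OF linL])
  with \<epsilon> show ?thesis by blast
qed

theorem theorem1p2:
  fixes f g :: "real ^ 'n \<Rightarrow> real"
  assumes "CARD('n) \<ge> 3"
    and "C2_on_sphere f" and "C2_on_sphere g"
    and "\<And>\<alpha> :: (real ^ 'n) set. plane_through_origin \<alpha> \<Longrightarrow>
           \<exists>a\<in>\<alpha>. \<exists>\<phi>\<in>SO2 \<alpha>. \<forall>u\<in>sphere 0 1 \<inter> \<alpha>. f (\<phi> u) + a \<bullet> u = g u"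
    and "\<And>\<alpha> :: (real ^ 'n) set. plane_through_origin \<alpha> \<Longrightarrow>
           \<not> direct_rigid_motion_symmetry \<alpha> f \<and> \<not> direct_rigid_motion_symmetry \<alpha> g"
  shows "\<exists>b :: real ^ 'n.
           (\<forall>u\<in>sphere 0 1. g u = f u + b \<bullet> u) \<or>
           (\<forall>u\<in>sphere 0 1. g u = f (- u) + b \<bullet> u)"
proof -
  let ?F = "radial_ext f" and ?G = "radial_ext g"
  have rigid: "\<not> direct_rigid_motion_symmetry \<alpha> f" if "plane_through_origin \<alpha>" for \<alpha>
    using assms(5)[OF that] by blast
  have sign: "\<exists>\<epsilon>. (\<epsilon> = 1 \<or> \<epsilon> = -1) \<and> matches ?F ?G \<epsilon> V"
    if "subspace V" "dim V = 3" for V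
    using ex_matching_sign[OF assms(2,3,4) rigid that] .
  have uminus: "uminus \<in> SO2 \<alpha>" if \<alpha>: "plane_through_origin \<alpha>" for \<alpha> :: "(real^'n) set"
  proof -
    obtain \<phi> where "\<phi> \<in> SO2 \<alpha>" using assms(4)[OF \<alpha>] by blast
    then obtain e where "orthonormal_frame \<alpha> e" by (auto simp: SO2_def)
    then show ?thesis using \<alpha> by (auto simp: plane_through_origin_def intro: uminus_in_SO2)
  qed
  have same: "\<epsilon> = \<epsilon>'"
    if "plane_through_origin \<alpha>" "\<alpha> \<subseteq> V" "\<alpha> \<subseteq> V'" "matches ?F ?G \<epsilon> V" "matches ?F ?G \<epsilon>' V'"
      "\<epsilon> = 1 \<or> \<epsilon> = -1" "\<epsilon>' = 1 \<or> \<epsilon>' = -1" for \<alpha> V V' \<epsilon> \<epsilon>'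
    using matches_plane_sign_unique[OF uminus[OF that(1)] that(1) rigid[OF that(1)]]
      matches_subset[OF that(4) that(2)] matches_subset[OF that(5) that(3)] that(6,7) by fastforce
  have ex3: "\<exists>V. subspace V \<and> dim V = 3 \<and> {x, y, z} \<subseteq> V" for x y z :: "real^'n"
  proof -
    have "dim {x, y, z} \<le> card {x, y, z}" by (rule dim_le_card') simp
    also have "\<dots> \<le> 3" by (simp add: card_insert_if)
    finally show ?thesis
      using ex_subspace_superset_dim[of "{x, y, z}" 3] assms(1) by (metis DIM_cart DIM_real mult.right_neutral)
  qed
  obtain V0 :: "(real^'n) set" where V0: "subspace V0" "dim V0 = 3" using ex3 by blast
  obtain \<epsilon> where \<epsilon>: "\<epsilon> = 1 \<or> \<epsilon> = -1" "matches ?F ?G \<epsilon> V0" using sign[OF V0] by blast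
  have indep: "\<exists>y\<in>V. y \<notin> span {x}" if V: "dim V = 3" for V and x :: "real^'n"
  proof (rule ccontr)
    assume "\<not> ?thesis"
    then have "dim V \<le> dim {x}" by (metis subsetI dim_subset dim_span)
    also have "\<dots> \<le> 1" by (simp add: dim_singleton)
    finally show False using V by simp
  qed
  have all: "matches ?F ?G \<epsilon> V" if V: "subspace V" "dim V = 3" for V
  proof -
    \<comment> \<open>The chain \<open>V0\<close>, \<open>V1\<close>, \<open>V2\<close>, \<open>V\<close> has consecutive members sharing the planes spanned by\<close>
    \<comment> \<open>\<open>x, x'\<close>, by \<open>x, y\<close> and by \<open>y, y'\<close>.\<close>
    obtain x where x: "x \<in> V0" "x \<noteq> 0" using indep[OF V0(2), of 0] by auto
    obtain x' where x': "x' \<in> V0" "x' \<notin> span {x}" using indep[OF V0(2)] by blast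
    obtain y where y: "y \<in> V" "y \<notin> span {x}" using indep[OF V(2)] by blast
    obtain y' where y': "y' \<in> V" "y' \<notin> span {y}" using indep[OF V(2)] by blast
    have y0: "y \<noteq> 0" using y(2) span_zero by metis
    obtain V1 where V1: "subspace V1" "dim V1 = 3" "{x, x', y} \<subseteq> V1" using ex3 by blast
    obtain V2 where V2: "subspace V2" "dim V2 = 3" "{x, y, y'} \<subseteq> V2" using ex3 by blast
    obtain \<epsilon>1 where \<epsilon>1: "\<epsilon>1 = 1 \<or> \<epsilon>1 = -1" "matches ?F ?G \<epsilon>1 V1" using sign[OF V1(1,2)] by blast
    obtain \<epsilon>2 where \<epsilon>2: "\<epsilon>2 = 1 \<or> \<epsilon>2 = -1" "matches ?F ?G \<epsilon>2 V2" using sign[OF V2(1,2)] by blast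
    obtain \<epsilon>3 where \<epsilon>3: "\<epsilon>3 = 1 \<or> \<epsilon>3 = -1" "matches ?F ?G \<epsilon>3 V" using sign[OF V] by blast
    have "\<epsilon> = \<epsilon>1"
      by (rule same[OF plane_through_origin_span[OF x(2) x'(2)] _ _ \<epsilon>(2) \<epsilon>1(2) \<epsilon>(1) \<epsilon>1(1)];
          rule span_minimal) (use x x' V0 V1 in auto)
    also have "\<epsilon>1 = \<epsilon>2"
      by (rule same[OF plane_through_origin_span[OF x(2) y(2)] _ _ \<epsilon>1(2) \<epsilon>2(2) \<epsilon>1(1) \<epsilon>2(1)];
          rule span_minimal) (use V1 V2 in auto)
    also have "\<epsilon>2 = \<epsilon>3"
      by (rule same[OF plane_through_origin_span[OF y0 y'(2)] _ _ \<epsilon>2(2) \<epsilon>3(2) \<epsilon>2(1) \<epsilon>3(1)];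
          rule span_minimal) (use y y' V V2 in auto)
    finally show ?thesis using \<epsilon>3 by simp
  qed
  define D where "D x = ?G x - ?F (\<epsilon> *\<^sub>R x)" for x
  have "linear D"
  proof (rule linearI)
    fix x y :: "real^'n" and c :: real
    obtain V where V: "subspace V" "dim V = 3" "{x, y, 0} \<subseteq> V" using ex3 by blast
    obtain b where b: "\<And>x. x \<in> V \<Longrightarrow> D x = b \<bullet> x"
      using all[OF V(1,2)] by (auto simp: matches_def D_def)
    show "D (x + y) = D x + D y" "D (c *\<^sub>R x) = c *\<^sub>R D x"
      using V by (simp_all add: b subspace_add subspace_scale inner_right_distrib)
  qed
  then have b: "D x = adjoint D 1 \<bullet> x" for x
    using adjoint_works[of D x 1] by (simp add: inner_commute)
  have "g u = f (\<epsilon> *\<^sub>R u) + adjoint D 1 \<bullet> u" if "u \<in> sphere 0 1" for u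
    using b[of u] that \<epsilon>(1) by (auto simp: D_def radial_ext_unit)
  then show ?thesis using \<epsilon>(1) by auto
qed

end
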